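(* (i) Let $|N|\geq 4$ and $|O|=3$. Then the random serial dictatorship mechanism RSD is at-most-$\frac{1}{6}$-agent-object-wasteful. (ii) Let $|N|=4$ and $|O|\geq 3$. Then the random serial dictatorship mechanism RSD is at-most-$\frac{1}{6}$-agent-object-wasteful.
   Context: Model. $N=\{1,\ldots,n\}$ is a finite set of agents and $O$ a finite set of objects. Each agent $i$ has a strict preference $R_i$, a linear order over $O\cup\{i\}$, where $i$ stands for being unassigned; $P_i$ is its asymmetric part, and $o\in O$ is acceptable to $i$ if $oP_ii$. $\mathcal{R}^N$ is the set of all profiles $R=(R_i)_{i\in N}$ of such linear orders. An assignment is a map $\mu$ on $N$ with $\mu_i\in O\cup\{i\}$ for all $i$ and $\mu_i\neq\mu_j$ for $i\neq j$; $\mathcal{M}$ is the set of assignments and $\Delta(\mathcal{M})$ the set of probability distributions over it. A mechanism is a map $f:\mathcal{R}^N\to\Delta(\mathcal{M})$; $f_{ia}(R)$ is the probability that $i$ is assigned $a\in O\cup\{i\}$ under $f(R)$, and $f_{oo}(R)=1-\sum_{j\in N}f_{jo}(R)$ for $o\in O$. RSD. For a strict priority order $\succ$ over $N$, the serial dictatorship $f^{\succ}$ lets agents choose one after another in the order $\succ$; each agent receives his most preferred element among his outside option and the objects not chosen by earlier agents. With $\Pi$ the set of all strict priority orders over $N$, $RSD(R)=\frac{1}{n!}\sum_{\succ\in\Pi}f^{\succ}(R)$ for all $R$. Waste. For $q\in[0,1]$, $f$ is $q$-agent-object-wasteful if there exist a profile $R$, $o\in O$ and $i\in N$ with $oP_ii$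 and $\min\{f_{ii}(R),f_{oo}(R)\}\ge q$. $f$ is at-most-$q$-agent-object-wasteful if $f$ is $q$-agent-object-wasteful and $f$ is not $q'$-agent-object-wasteful for any $q'>q$. *)

theory Defs
  imports "HOL-Probability.Probability" "HOL-Combinatorics.Multiset_Permutations"
begin

text \<open>
  The finite sets of agents and of objects are the universes of finite types 'i and 'o.
  \<open>Self i\<close> is the outside option of agent \<open>i\<close>, which the literature also denotes by \<open>i\<close>.
\<close>

datatype ('i, 'o) outcome = Self 'i | Obj 'o

definition outcomes :: "'i \<Rightarrow> ('i, 'o) outcome set" where
  "outcomes i = insert (Self i) (range Obj)"

text \<open>\<open>(a, b) \<in> R i\<close> means that agent \<open>i\<close> finds \<open>a\<close> at least as good as \<open>b\<close>.\<close>

type_synonym ('i, 'o) profile = "'i \<Rightarrow> ('i, 'o) outcome rel"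

definition profiles :: "('i, 'o) profile set" where
  "profiles = {R. \<forall>i. linear_order_on (outcomes i) (R i)}"

definition prefers :: "('i, 'o) profile \<Rightarrow> 'i \<Rightarrow> ('i, 'o) outcome \<Rightarrow> ('i, 'o) outcome \<Rightarrow> bool" where
  "prefers R i a b \<longleftrightarrow> (a, b) \<in> R i \<and> (b, a) \<notin> R i"

definition assignments :: "('i \<Rightarrow> ('i, 'o) outcome) set" where
  "assignments = {\<mu>. (\<forall>i. \<mu> i \<in> outcomes i) \<and> (\<forall>i j. i \<noteq> j \<longrightarrow> \<mu> i \<noteq> \<mu> j)}"

text \<open>Only the values on \<^const>\<open>profiles\<close> are meaningful.\<close>

type_synonym ('i, 'o) mechanism = "('i, 'o) profile \<Rightarrow> ('i \<Rightarrow> ('i, 'o) outcome) pmf"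

definition is_mechanism :: "('i, 'o) mechanism \<Rightarrow> bool" where
  "is_mechanism f \<longleftrightarrow> (\<forall>R\<in>profiles. set_pmf (f R) \<subseteq> assignments)"

definition assign_prob ::
    "('i, 'o) mechanism \<Rightarrow> ('i, 'o) profile \<Rightarrow> 'i \<Rightarrow> ('i, 'o) outcome \<Rightarrow> real" where
  "assign_prob f R i a = measure_pmf.prob (f R) {\<mu>. \<mu> i = a}"

definition free_prob ::
    "('i::finite, 'o) mechanism \<Rightarrow> ('i, 'o) profile \<Rightarrow> 'o \<Rightarrow> real" where
  "free_prob f R x = 1 - (\<Sum>j\<in>UNIV. assign_prob f R j (Obj x))"

definition wasteful :: "real \<Rightarrow> ('i::finite, 'o) mechanism \<Rightarrow> bool" where
  "wasteful q f \<longleftrightarrow>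
     (\<exists>R\<in>profiles. \<exists>x i. prefers R i (Obj x) (Self i) \<and>
        min (assign_prob f R i (Self i)) (free_prob f R x) \<ge> q)"

definition at_most_wasteful :: "real \<Rightarrow> ('i::finite, 'o) mechanism \<Rightarrow> bool" where
  "at_most_wasteful q f \<longleftrightarrow> wasteful q f \<and> (\<forall>q'>q. \<not> wasteful q' f)"

definition best :: "'a rel \<Rightarrow> 'a set \<Rightarrow> 'a" where
  "best r A = (THE a. a \<in> A \<and> (\<forall>b\<in>A. (a, b) \<in> r))"

text \<open>
  A strict priority order over the agents is represented by the list of all agents from highest
  to lowest priority. In \<open>serve is A R\<close> the agents in the list \<open>is\<close> choose in turn,
  starting from the set \<open>A\<close> of remaining objects.
\<close>

primrec serve ::
    "'i list \<Rightarrow> 'o set \<Rightarrow> ('i, 'o) profile \<Rightarrow> 'i \<Rightarrow> ('i, 'o) outcome" where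
  "serve [] A R = Self"
| "serve (i # is) A R =
     (let a = best (R i) (insert (Self i) (Obj ` A))
      in (serve is {x \<in> A. Obj x \<noteq> a} R)(i := a))"

definition serial_dictatorship :: "'i list \<Rightarrow> ('i, 'o) mechanism" where
  "serial_dictatorship p R = return_pmf (serve p UNIV R)"

definition RSD :: "('i::finite, 'o) mechanism" where
  "RSD R = bind_pmf (pmf_of_set (permutations_of_set UNIV)) (\<lambda>p. serial_dictatorship p R)"

lemma pmf_RSD:
  "pmf (RSD R) \<mu> =
     1 / fact CARD('i) *
       (\<Sum>p\<in>permutations_of_set UNIV. pmf (serial_dictatorship p R) (\<mu> :: 'i::finite \<Rightarrow> ('i, 'o) outcome))"
  unfolding RSD_def
  by (subst pmf_bind_pmf_of_set) simp_all

lemma best_exists: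
  assumes "linear_order_on B r" "finite A" "A \<noteq> {}" "A \<subseteq> B"
  shows "\<exists>!a. a \<in> A \<and> (\<forall>b\<in>A. (a, b) \<in> r)"
proof -
  have r: "refl_on B r" "trans r" "antisym r" "total_on B r"
    using assms(1) by (auto simp: order_on_defs)
  have "\<exists>a. a \<in> A \<and> (\<forall>b\<in>A. (a, b) \<in> r)"
    using assms(2-4)
  proof (induction A rule: finite_ne_induct)
    case (singleton x)
    then show ?case using r(1) by (auto simp: refl_on_def)
  next
    case (insert x F)
    then obtain a where a: "a \<in> F" "\<forall>b\<in>F. (a, b) \<in> r" by auto
    have "(x, a) \<in> r \<or> (a, x) \<in> r" "(x, x) \<in> r"
      using r(1,4) a(1) insert.prems by (cases "x = a"; simp add: refl_on_def total_on_def subset_iff)+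
    then have "(x, a) \<in> r \<and> (\<forall>b\<in>F. (x, b) \<in> r) \<or> (a, x) \<in> r"
      using a(2) r(2) by (auto dest: transD)
    with a \<open>(x, x) \<in> r\<close> show ?case by auto
  qed
  then show ?thesis using r(3) by (auto dest: antisymD)
qed

lemma best:
  assumes "linear_order_on B r" "finite A" "A \<noteq> {}" "A \<subseteq> B"
  shows "best r A \<in> A" "b \<in> A \<Longrightarrow> (best r A, b) \<in> r"
  using theI'[OF best_exists[OF assms]] by (auto simp: best_def)

lemma serve_outcomes:
  fixes R :: "('i, 'o::finite) profile"
  assumes "R \<in> profiles"
  shows "serve p A R i \<in> insert (Self i) (Obj ` A)"
proof (induction p arbitrary: A)
  case (Cons j p)
  have "best (R j) (insert (Self j) (Obj ` A)) \<in> insert (Self j) (Obj ` A)"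
    using assms by (intro best(1)[of "outcomes j"]) (auto simp: profiles_def outcomes_def)
  moreover have "serve p {x \<in> A. Obj x \<noteq> best (R j) (insert (Self j) (Obj ` A))} R i
      \<in> insert (Self i) (Obj ` A)"
    using Cons.IH by blast
  ultimately show ?case by (auto simp: Let_def)
qed simp

lemma serve_inj:
  fixes R :: "('i, 'o::finite) profile"
  assumes "R \<in> profiles" "i \<noteq> j"
  shows "serve p A R i \<noteq> serve p A R j"
proof (induction p arbitrary: A)
  case (Cons k p)
  let ?a = "best (R k) (insert (Self k) (Obj ` A))"
  let ?A = "{x \<in> A. Obj x \<noteq> ?a}"
  have a: "?a \<in> insert (Self k) (Obj ` A)"
    using assms by (intro best(1)[of "outcomes k"]) (auto simp: profiles_def outcomes_def)
  have *: "serve p ?A R l \<noteq> ?a" if "l \<noteq> k" for l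
    using serve_outcomes[OF assms(1), of p ?A l] a that by auto
  note eq = serve.simps(2)[of k p A R, unfolded Let_def]
  consider "i = k" | "j = k" | "i \<noteq> k" "j \<noteq> k" by blast
  then show ?case
  proof cases
    case 1
    with assms(2) *[of j, symmetric] show ?thesis by (simp add: eq del: serve.simps)
  next
    case 2
    with assms(2) *[of i] show ?thesis by (simp add: eq del: serve.simps)
  next
    case 3
    with Cons.IH[of ?A] show ?thesis by (simp add: eq del: serve.simps)
  qed
qed (use assms in simp)

lemma RSD_mechanism: "is_mechanism (RSD :: ('i::finite, 'o::finite) mechanism)"
  unfolding is_mechanism_def
proof (intro ballI subsetI)
  fix R :: "('i, 'o) profile" and \<mu>
  assume R: "R \<in> profiles" and "\<mu> \<in> set_pmf (RSD R)"
  then obtain p where \<mu>: "\<mu> = serve p UNIV R"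
    by (auto simp: RSD_def serial_dictatorship_def)
  show "\<mu> \<in> assignments"
    unfolding assignments_def \<mu>
    using serve_outcomes[OF R, of p UNIV] serve_inj[OF R, of _ _ p UNIV]
    by (simp add: outcomes_def)
qed

end

theory Submission
  imports Defs
begin

text \<open>
  Fix a profile, an agent \<open>i\<close> and an object \<open>x\<close> acceptable to \<open>i\<close>. Suppose \<open>x\<close> stays free under
  some order \<open>p0\<close>. Then everyone who finds \<open>x\<close> acceptable gets something better under \<open>p0\<close>, and different
  agents get different objects. If \<open>i\<close> is unassigned under an order \<open>p\<close>, some \<open>w\<close> holds \<open>x\<close>, so the
  objects that \<open>i\<close> and \<open>w\<close> have under \<open>p0\<close> are held under \<open>p\<close> by two further agents \<open>y\<close> and \<open>z\<close>,
  with \<open>w\<close> and \<open>y\<close> choosing before \<open>i\<close> and \<open>z\<close> choosing before \<open>w\<close>.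

  With four agents, \<open>i\<close> therefore chooses last, and two of the six orders of the others are excluded: those
  starting with \<open>w\<close> if always the same \<open>w\<close> gets \<open>x\<close>, and otherwise those in which the agent who never
  gets \<open>x\<close> chooses third. This leaves 4 of 24 orders.

  With three objects, \<open>i\<close> and one agent \<open>j\<close> are the only ones to accept \<open>x\<close>. If only two other agents
  accept one of the two remaining objects, the 4 of 24 orders above bound the probability that \<open>i\<close> is
  unassigned; with more such agents it is, except in one case, the probability that \<open>x\<close> is free that
  is at most 1/6, because \<open>i\<close> and \<open>j\<close> must both choose before them.

  The bound is attained when \<open>i\<close> ranks \<open>a\<close> over \<open>x\<close>, \<open>j\<close> ranks \<open>b\<close> over \<open>x\<close>, and
  two others rank \<open>b\<close> over \<open>a\<close>.
\<close>

subsection \<open>Order patterns in a random permutation\<close>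

text \<open>Recursive instead of by positions, so that restricting and relabelling an order
  (\<open>filter\<close>, \<open>map\<close>) are plain inductions. On distinct lists it is a strict
  total order of the entries.\<close>

primrec before :: "'a list \<Rightarrow> 'a \<Rightarrow> 'a \<Rightarrow> bool" where
  "before [] x y \<longleftrightarrow> False"
| "before (z # zs) x y \<longleftrightarrow> z = x \<and> y \<in> set zs \<or> before zs x y"

lemma before_in_set: "before p x y \<Longrightarrow> x \<in> set p \<and> y \<in> set p"
  by (induction p) auto

lemma before_irrefl: "distinct p \<Longrightarrow> \<not> before p x x"
  by (induction p) (auto dest: before_in_set)

lemma before_trans: "distinct p \<Longrightarrow> before p x y \<Longrightarrow> before p y z \<Longrightarrow> before p x z"
  by (induction p) (auto dest: before_in_set)

lemma before_asym: "distinct p \<Longrightarrow> before p x y \<Longrightarrow> \<not> before p y x"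
  using before_irrefl before_trans by metis

lemma before_total: "x \<in> set p \<Longrightarrow> y \<in> set p \<Longrightarrow> x \<noteq> y \<Longrightarrow> before p x y \<or> before p y x"
  by (induction p) auto

lemma before_filter: "before (filter P p) x y \<longleftrightarrow> P x \<and> P y \<and> before p x y"
  by (induction p) auto

lemma before_map:
  "inj_on f (insert x (insert y (set p))) \<Longrightarrow> before (map f p) (f x) (f y) \<longleftrightarrow> before p x y"
  by (induction p) (auto simp: inj_on_def)

lemma filter_random_permutation:
  assumes "finite A"
  shows "map_pmf (filter P) (pmf_of_set (permutations_of_set A)) =
         pmf_of_set (permutations_of_set {x \<in> A. P x})"
proof -
  have "map_pmf fst (map_pmf (partition P) (pmf_of_set (permutations_of_set A))) =
        pmf_of_set (permutations_of_set {x \<in> A. P x})"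
    by (simp only: partition_random_permutations[OF assms] map_fst_pair_pmf)
  then show ?thesis
    by (simp add: pmf.map_comp o_def)
qed

abbreviation rperm :: "'i::finite list pmf" where
  "rperm \<equiv> pmf_of_set (permutations_of_set UNIV)"

text \<open>A uniform order restricted to the agents in \<open>ss\<close> is a uniform order of
  them, and replacing agents by their indices leaves a count that can be evaluated. The guards
  \<open>m < k\<close> and \<open>n < k\<close> make the relation passed to the arbitrary
  \<open>Q\<close> equal to \<open>before q\<close> everywhere, also where \<open>ss ! m\<close> is
  unspecified.\<close>

lemma prob_rperm_pattern:
  fixes ss :: "'i::finite list"
  assumes "distinct ss" and k: "length ss = k"
    and c: "length (filter (\<lambda>q. Q (before q)) (permutations_of_set_list [0..<k])) = c"
  shows "measure_pmf.prob rperm {p. Q (\<lambda>m n. m < k \<and> n < k \<and> before p (ss ! m) (ss ! n))} =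
         c / fact k"
proof -
  let ?Q = "\<lambda>p. Q (\<lambda>m n. m < k \<and> n < k \<and> before p (ss ! m) (ss ! n))"
  have inj: "inj_on ((!) ss) {..<k}"
    using assms(1) k by (intro inj_on_nth) auto
  have img: "(!) ss ` {..<k} = set ss"
    using k by (auto simp: set_conv_nth)
  have card: "card (set ss) = k"
    using assms(1) k by (simp add: distinct_card)
  have "rperm \<bind> (\<lambda>p. return_pmf (filter (\<lambda>x. x \<in> set ss) p)) =
        pmf_of_set (permutations_of_set (set ss))"
    using filter_random_permutation[of "UNIV :: 'i set" "\<lambda>x. x \<in> set ss"] by (simp add: map_pmf_def)
  then have f: "map_pmf (filter (\<lambda>x. x \<in> set ss)) rperm = pmf_of_set (permutations_of_set (set ss))"
    by (simp add: map_pmf_def)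
  have g: "pmf_of_set (permutations_of_set (set ss)) =
      map_pmf (map ((!) ss)) (pmf_of_set (permutations_of_set {..<k}))"
    unfolding img[symmetric] permutations_of_set_image_inj[OF inj]
    by (rule map_pmf_of_set_inj[symmetric]) (simp_all add: inj_on_mapI inj)
  have "measure_pmf.prob rperm {p. ?Q p} =
        measure_pmf.prob (map_pmf (filter (\<lambda>x. x \<in> set ss)) rperm) {p. ?Q p}"
    using k by (simp add: before_filter cong: conj_cong)
  also have "\<dots> = measure_pmf.prob (pmf_of_set (permutations_of_set {..<k})) (map ((!) ss) -` {p. ?Q p})"
    by (simp add: f g)
  also have "\<dots> = measure_pmf.prob (pmf_of_set (permutations_of_set {..<k})) {q. Q (before q)}"
  proof (rule measure_pmf.finite_measure_eq_AE)
    have "(\<lambda>m n. m < k \<and> n < k \<and> before (map ((!) ss) q) (ss ! m) (ss ! n)) = before q"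
      if "q \<in> permutations_of_set {..<k}" for q
    proof (intro ext)
      fix m n
      have q: "set q = {..<k}" using that by (simp add: permutations_of_set_def)
      show "(m < k \<and> n < k \<and> before (map ((!) ss) q) (ss ! m) (ss ! n)) = before q m n"
      proof (cases "m < k \<and> n < k")
        case True
        then have "insert m (insert n (set q)) = {..<k}" using q by auto
        then show ?thesis using True before_map[of "(!) ss" m n q] inj by simp
      next
        case False
        then show ?thesis using before_in_set[of q m n] q by auto
      qed
    qed
    then show "AE q in measure_pmf (pmf_of_set (permutations_of_set {..<k})).
        (q \<in> map ((!) ss) -` {p. ?Q p}) = (q \<in> {q. Q (before q)})"
      by (auto simp: AE_measure_pmf_iff)
  qed auto
  also have "\<dots> = card {q \<in> permutations_of_set {..<k}. Q (before q)} / fact k"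
    by (subst measure_pmf_of_set) (auto simp: Int_def)
  also have "permutations_of_set {..<k} = set (permutations_of_set_list [0..<k])"
    using permutations_of_list[of "[0..<k]"] by (simp add: atLeast0LessThan)
  also have "card {q \<in> \<dots>. Q (before q)} = length (filter (\<lambda>q. Q (before q)) (permutations_of_set_list [0..<k]))"
    by (subst distinct_card[symmetric])
       (auto intro!: arg_cong[where f = card] distinct_filter distinct_permutations_of_set_list)
  finally show ?thesis using c by simp
qed

lemma prob_last_not_first:
  assumes "distinct [i, j, k, l :: 'i::finite]"
  shows "measure_pmf.prob rperm {p. before p j i \<and> before p k i \<and> before p l i \<and>
           (before p k j \<or> before p l j)} = 1 / 6"
proof -
  let ?Q = "\<lambda>b. b 1 0 \<and> b 2 0 \<and> b 3 0 \<and> (b 2 1 \<or> b 3 1)"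
  have "length (filter (\<lambda>q. ?Q (before q)) (permutations_of_set_list [0..<4])) = 4"
    by code_simp
  from prob_rperm_pattern[where Q = ?Q, OF assms _ this] show ?thesis
    by (simp add: fact_numeral)
qed

lemma prob_last_not_last_but_one:
  assumes "distinct [i, j, k, l :: 'i::finite]"
  shows "measure_pmf.prob rperm {p. before p j i \<and> before p k i \<and> before p l i \<and>
           (before p j k \<or> before p j l)} = 1 / 6"
proof -
  let ?Q = "\<lambda>b. b 1 0 \<and> b 2 0 \<and> b 3 0 \<and> (b 1 2 \<or> b 1 3)"
  have "length (filter (\<lambda>q. ?Q (before q)) (permutations_of_set_list [0..<4])) = 4"
    by code_simp
  from prob_rperm_pattern[where Q = ?Q, OF assms _ this] show ?thesis
    by (simp add: fact_numeral)
qed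

lemma prob_two_first:
  assumes "distinct [i, j, k, l :: 'i::finite]"
  shows "measure_pmf.prob rperm {p. before p i k \<and> before p i l \<and> before p j k \<and> before p j l} = 1 / 6"
proof -
  let ?Q = "\<lambda>b. b 0 2 \<and> b 0 3 \<and> b 1 2 \<and> b 1 3"
  have "length (filter (\<lambda>q. ?Q (before q)) (permutations_of_set_list [0..<4])) = 4"
    by code_simp
  from prob_rperm_pattern[where Q = ?Q, OF assms _ this] show ?thesis
    by (simp add: fact_numeral)
qed

text \<open>The two groups of agents are disjoint, so their relative orders are independent: 1/3
  times 1/2.\<close>

lemma prob_first_of_three_and_two:
  assumes "distinct [i, j, k, l, m :: 'i::finite]"
  shows "measure_pmf.prob rperm {p. before p i k \<and> before p i l \<and> before p j m} = 1 / 6"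
proof -
  let ?Q = "\<lambda>b. b 0 2 \<and> b 0 3 \<and> b 1 4"
  have "length (filter (\<lambda>q. ?Q (before q)) (permutations_of_set_list [0..<5])) = 20"
    by code_simp
  from prob_rperm_pattern[where Q = ?Q, OF assms _ this] show ?thesis
    by (simp add: fact_numeral)
qed

text \<open>Of 120 orders, 6 have \<open>j\<close> fourth and \<open>i\<close> fifth, and 12 have
  \<open>j\<close> third with \<open>i\<close> behind him.\<close>

lemma prob_two_of_three_before:
  assumes "distinct [i, j, k, l, m :: 'i::finite]"
  shows "measure_pmf.prob rperm {p. before p j i \<and> (before p k j \<and> before p l j \<or>
           before p k j \<and> before p m j \<or> before p l j \<and> before p m j)} = 3 / 20"
proof -
  let ?Q = "\<lambda>b. b 1 0 \<and> (b 2 1 \<and> b 3 1 \<or> b 2 1 \<and> b 4 1 \<or> b 3 1 \<and> b 4 1)"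
  have "length (filter (\<lambda>q. ?Q (before q)) (permutations_of_set_list [0..<5])) = 18"
    by code_simp
  from prob_rperm_pattern[where Q = ?Q, OF assms _ this] show ?thesis
    by (simp add: fact_numeral)
qed

text \<open>\<open>i\<close> leads the six with probability 1/6; independently, \<open>j\<close>
  precedes \<open>k\<close> with probability 1/2.\<close>

lemma prob_first_of_six:
  assumes "distinct [i, j, k, l, m, n :: 'i::finite]"
  shows "measure_pmf.prob rperm {p. before p i j \<and> before p i k \<and> before p i l \<and> before p i m \<and>
           before p i n \<and> before p j k} = 1 / 12"
proof -
  let ?Q = "\<lambda>b. b 0 1 \<and> b 0 2 \<and> b 0 3 \<and> b 0 4 \<and> b 0 5 \<and> b 1 2"
  have "length (filter (\<lambda>q. ?Q (before q)) (permutations_of_set_list [0..<6])) = 60"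
    by code_simp
  from prob_rperm_pattern[where Q = ?Q, OF assms _ this] show ?thesis
    by (simp add: fact_numeral)
qed

lemma rperm_mono:
  fixes A B :: "'i::finite list set"
  assumes "\<And>p. p \<in> permutations_of_set UNIV \<Longrightarrow> p \<in> A \<Longrightarrow> p \<in> B"
  shows "measure_pmf.prob rperm A \<le> measure_pmf.prob rperm B"
  using assms by (intro measure_pmf.finite_measure_mono_AE) (auto simp: AE_measure_pmf_iff)

lemma rperm_pos:
  fixes Q :: "'i::finite list \<Rightarrow> bool"
  assumes "measure_pmf.prob rperm {p. Q p} > 0"
  obtains p where "p \<in> permutations_of_set UNIV" "Q p"
proof -
  have "\<exists>p. p \<in> permutations_of_set UNIV \<and> Q p"
  proof (rule ccontr)
    assume "\<nexists>p. p \<in> permutations_of_set UNIV \<and> Q p"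
    then have "measure_pmf.prob rperm {p. Q p} \<le> measure_pmf.prob rperm ({} :: 'i list set)"
      by (intro rperm_mono) auto
    with assms show False by simp
  qed
  then show ?thesis using that by blast
qed

subsection \<open>Random serial dictatorship\<close>

lemma assign_prob_RSD:
  "assign_prob RSD R i a = measure_pmf.prob rperm {p. serve p UNIV R i = a}"
proof -
  have "RSD R = map_pmf (\<lambda>p. serve p UNIV R) rperm"
    by (simp add: RSD_def serial_dictatorship_def map_pmf_def)
  then show ?thesis by (simp add: assign_prob_def vimage_def)
qed

text \<open>No two agents hold the same object, so the events summed in \<open>free_prob\<close> are
  disjoint.\<close>

lemma free_prob_RSD:
  fixes R :: "('i::finite, 'o::finite) profile"
  assumes "R \<in> profiles"
  shows "free_prob RSD R x = measure_pmf.prob rperm {p. \<forall>j. serve p UNIV R j \<noteq> Obj x}"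
proof -
  let ?T = "\<lambda>j. {p. serve p UNIV R j = Obj x}"
  have "(\<Sum>j\<in>UNIV. assign_prob RSD R j (Obj x)) = measure_pmf.prob rperm (\<Union>j. ?T j)"
    unfolding assign_prob_RSD
    using serve_inj[OF assms]
    by (subst measure_pmf.finite_measure_finite_Union) (auto simp: disjoint_family_on_def, metis)
  also have "1 - \<dots> = measure_pmf.prob rperm (UNIV - (\<Union>j. ?T j))"
    using measure_pmf.prob_compl[of "\<Union>j. ?T j" "rperm :: 'i list pmf"] by simp
  also have "UNIV - (\<Union>j. ?T j) = {p. \<forall>j. serve p UNIV R j \<noteq> Obj x}" by auto
  finally show ?thesis by (simp add: free_prob_def)
qed

lemma best_mem:
  fixes R :: "('i, 'o::finite) profile"
  assumes "R \<in> profiles"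
  shows "best (R i) (insert (Self i) (Obj ` A)) \<in> insert (Self i) (Obj ` A)"
    and "b \<in> insert (Self i) (Obj ` A) \<Longrightarrow> (best (R i) (insert (Self i) (Obj ` A)), b) \<in> R i"
proof -
  have *: "linear_order_on (outcomes i) (R i)" "finite (insert (Self i) (Obj ` A))"
    "insert (Self i) (Obj ` A) \<noteq> {}" "insert (Self i) (Obj ` A) \<subseteq> outcomes i"
    using assms by (auto simp: profiles_def outcomes_def)
  show "best (R i) (insert (Self i) (Obj ` A)) \<in> insert (Self i) (Obj ` A)"
    by (rule best(1)[OF *])
  show "b \<in> insert (Self i) (Obj ` A) \<Longrightarrow> (best (R i) (insert (Self i) (Obj ` A)), b) \<in> R i"
    by (rule best(2)[OF *])
qed

lemma serve_rational:
  fixes R :: "('i, 'o::finite) profile"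
  assumes "R \<in> profiles"
  shows "(serve p A R i, Self i) \<in> R i"
proof (induction p arbitrary: A)
  case Nil
  have "refl_on (outcomes i) (R i)" using assms by (simp add: profiles_def order_on_defs)
  then show ?case by (simp add: refl_on_def outcomes_def)
next
  case (Cons k p)
  then show ?case using best_mem[OF assms] by (simp add: Let_def)
qed

text \<open>At his turn an agent takes the best of what remains, so an object he prefers to his own
  was already taken by a predecessor. Besides this, the arguments below use only
  \<open>serve_outcomes\<close>, \<open>serve_inj\<close> and \<open>serve_rational\<close> about
  serial dictatorship.\<close>

lemma serve_envy:
  fixes R :: "('i, 'o::finite) profile"
  assumes "R \<in> profiles" "distinct p" "i \<in> set p" "c \<in> A"
    and "prefers R i (Obj c) (serve p A R i)"
  shows "\<exists>j. before p j i \<and> serve p A R j = Obj c"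
  using assms(2-)
proof (induction p arbitrary: A)
  case (Cons k p)
  let ?a = "best (R k) (insert (Self k) (Obj ` A))"
  let ?A = "{x \<in> A. Obj x \<noteq> ?a}"
  show ?case
  proof (cases "i = k")
    case True
    then show ?thesis using Cons.prems best_mem(2)[OF assms(1), of "Obj c" k A]
      by (simp add: Let_def prefers_def)
  next
    case False
    then have i: "i \<in> set p" and pref: "prefers R i (Obj c) (serve p ?A R i)"
      using Cons.prems by (auto simp: Let_def)
    show ?thesis
    proof (cases "Obj c = ?a")
      case True
      then show ?thesis using i by (intro exI[of _ k]) (simp add: Let_def)
    next
      case c: False
      then obtain j where j: "before p j i" "serve p ?A R j = Obj c"
        using Cons.IH[of ?A] Cons.prems i pref by auto
      then have "j \<noteq> k" using Cons.prems before_in_set by fastforce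
      then show ?thesis using j by (intro exI[of _ j]) (simp add: Let_def)
    qed
  qed
qed simp

section \<open>Envy and free objects at a fixed profile\<close>

locale serial =
  fixes R :: "('i::finite, 'o::finite) profile"
  assumes R: "R \<in> profiles"
begin

abbreviation orders :: "'i list set" where
  "orders \<equiv> permutations_of_set UNIV"

abbreviation \<mu> :: "'i list \<Rightarrow> 'i \<Rightarrow> ('i, 'o) outcome" where
  "\<mu> p \<equiv> serve p UNIV R"

abbreviation likes :: "'i \<Rightarrow> 'o \<Rightarrow> bool" where
  "likes i c \<equiv> prefers R i (Obj c) (Self i)"

abbreviation above :: "'i \<Rightarrow> 'o \<Rightarrow> 'o \<Rightarrow> bool" where
  "above i c d \<equiv> prefers R i (Obj c) (Obj d)"

lemma lin: "linear_order_on (outcomes i) (R i)"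
  using R by (simp add: profiles_def)

lemma prefers_total:
  assumes "a \<in> outcomes i" "b \<in> outcomes i" "a \<noteq> b"
  shows "prefers R i a b \<or> prefers R i b a"
  using lin[of i] assms unfolding prefers_def order_on_defs total_on_def antisym_def by blast

lemma prefers_trans: "prefers R i a b \<Longrightarrow> prefers R i b c \<Longrightarrow> prefers R i a c"
  using lin[of i] unfolding prefers_def order_on_defs trans_def by blast

lemma outcomesI [simp, intro]: "Self i \<in> outcomes i" "Obj c \<in> outcomes i"
  by (simp_all add: outcomes_def)

lemma \<mu>_cases: "\<mu> p i = Self i \<or> (\<exists>c. \<mu> p i = Obj c)"
  using serve_outcomes[OF R, of p UNIV i] by auto

lemma \<mu>_inj: "\<mu> p i = Obj c \<Longrightarrow> \<mu> p j = Obj c \<Longrightarrow> i = j"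
  using serve_inj[OF R, of i j p UNIV] by auto

lemma \<mu>_likes: "\<mu> p i = Obj c \<Longrightarrow> likes i c"
  using serve_rational[OF R, of p UNIV i] lin[of i]
  by (auto simp: prefers_def order_on_defs antisym_def)

lemma envy:
  assumes "p \<in> orders" "prefers R i (Obj c) (\<mu> p i)"
  obtains j where "before p j i" "\<mu> p j = Obj c"
  using serve_envy[OF R, of p i c UNIV] assms by (auto dest: permutations_of_setD)

text \<open>Nobody can envy an object that nobody holds, so an agent accepting \<open>x\<close> has
  something better, which cannot be his outside option.\<close>

lemma free_above:
  assumes "p \<in> orders" "\<forall>j. \<mu> p j \<noteq> Obj x" "likes i x"
  obtains c where "\<mu> p i = Obj c" "above i c x"
proof -
  have n: "\<not> prefers R i (Obj x) (\<mu> p i)" using envy[OF assms(1)] assms(2) by metis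
  with assms(3) have "\<mu> p i \<noteq> Self i" by auto
  then obtain c where c: "\<mu> p i = Obj c" using \<mu>_cases by metis
  with n assms(2) have "above i c x" using prefers_total[of "Obj c" i "Obj x"] by auto
  with c that show ?thesis by blast
qed

lemma order_rules:
  assumes "p \<in> orders"
  shows "\<not> before p a a" "before p a b \<Longrightarrow> \<not> before p b a"
    "before p a b \<Longrightarrow> before p b c \<Longrightarrow> before p a c" "a \<noteq> b \<Longrightarrow> before p a b \<or> before p b a"
proof -
  have "distinct p" "set p = UNIV" using assms by (auto dest: permutations_of_setD)
  then show "\<not> before p a a" "before p a b \<Longrightarrow> \<not> before p b a"
    "before p a b \<Longrightarrow> before p b c \<Longrightarrow> before p a c" "a \<noteq> b \<Longrightarrow> before p a b \<or> before p b a"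
    by (simp_all add: before_irrefl before_asym before_total) (rule before_trans)
qed

text \<open>Three uses of \<open>envy\<close>: under \<open>p\<close>, the unassigned
  \<open>i\<close> envies \<open>w\<close> for \<open>x\<close> and \<open>y\<close> for what
  \<open>i\<close> has under \<open>p0\<close>, while \<open>w\<close> envies \<open>z\<close> for
  what \<open>w\<close> has under \<open>p0\<close>.\<close>

lemma waste_witnesses:
  assumes p0: "p0 \<in> orders" "\<forall>j. \<mu> p0 j \<noteq> Obj x" and i: "likes i x" "\<mu> p0 i = Obj \<alpha>"
    and p: "p \<in> orders" "\<mu> p i = Self i"
  obtains w y z \<beta> where "distinct [i, w, y, z]" "\<mu> p w = Obj x" "\<mu> p y = Obj \<alpha>" "\<mu> p z = Obj \<beta>"
    "\<mu> p0 w = Obj \<beta>" "before p w i" "before p y i" "before p z w" "\<alpha> \<noteq> \<beta>" "likes w x" "above w \<beta> x"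
proof -
  have \<alpha>: "above i \<alpha> x" using free_above[OF p0 i(1)] i(2) by auto
  obtain w where w: "before p w i" "\<mu> p w = Obj x"
    using envy[OF p(1), of i x] i(1) p(2) by auto
  obtain y where y: "before p y i" "\<mu> p y = Obj \<alpha>"
    using envy[OF p(1), of i \<alpha>] prefers_trans[OF \<alpha> i(1)] p(2) by auto
  have lw: "likes w x" using \<mu>_likes[OF w(2)] .
  obtain \<beta> where \<beta>: "\<mu> p0 w = Obj \<beta>" "above w \<beta> x"
    using free_above[OF p0 lw] by blast
  obtain z where z: "before p z w" "\<mu> p z = Obj \<beta>"
    using envy[OF p(1), of w \<beta>] w(2) \<beta>(2) by auto
  have wi: "w \<noteq> i" using w(2) p(2) by auto
  then have "\<alpha> \<noteq> \<beta>" using \<mu>_inj[of p0 w \<beta> i] \<beta>(1) i(2) by auto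
  moreover have "\<alpha> \<noteq> x" "\<beta> \<noteq> x" using p0(2) i(2) \<beta>(1) by metis+
  \<comment> \<open>The outcomes of the four agents under \<open>p\<close> are
    \<open>Self i\<close>, \<open>x\<close>, \<alpha> and \<beta>, all different.\<close>
  ultimately have "i \<noteq> w" "i \<noteq> y" "i \<noteq> z" "w \<noteq> y" "w \<noteq> z" "y \<noteq> z"
    using wi w(2) y(2) z(2) p(2) by force+
  then have "distinct [i, w, y, z]" by simp
  from that[OF this w(2) y(2) z(2) \<beta>(1) w(1) y(1) z(1) \<open>\<alpha> \<noteq> \<beta>\<close> lw \<beta>(2)] show ?thesis .
qed

section \<open>Upper bounds for four agents and for three objects\<close>

text \<open>The four witnesses exhaust the agents, so \<open>i\<close> chooses last whenever he is
  unassigned. That \<open>x\<close> can stay free enters only through the single order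
  \<open>p0\<close>.\<close>

lemma four_agents:
  assumes "CARD('i) = 4"
    and p0: "p0 \<in> orders" "\<forall>j. \<mu> p0 j \<noteq> Obj x" and i: "likes i x"
  shows "measure_pmf.prob rperm {p. \<mu> p i = Self i} \<le> 1 / 6"
proof (cases "\<exists>p1 \<in> orders. \<mu> p1 i = Self i")
  case False
  then have "measure_pmf.prob rperm {p. \<mu> p i = Self i} \<le> measure_pmf.prob rperm ({} :: 'i list set)"
    by (intro rperm_mono) auto
  then show ?thesis by simp
next
  case True
  then obtain p1 where p1: "p1 \<in> orders" "\<mu> p1 i = Self i" by blast
  obtain \<alpha> where \<alpha>: "\<mu> p0 i = Obj \<alpha>" using free_above[OF p0 i] by blast
  note wit = waste_witnesses[OF p0 i \<alpha>]
  have all: "a = b \<or> a = c \<or> a = d \<or> a = e" if "distinct [b, c, d, e]" for a b c d e :: 'i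
  proof -
    have "card {b, c, d, e} = CARD('i)" using that assms(1) by auto
    then have "{b, c, d, e} = UNIV" by (intro card_subset_eq) auto
    then show ?thesis by auto
  qed
  obtain w y z \<beta> where w: "distinct [i, w, y, z]" "\<mu> p1 w = Obj x" "\<mu> p1 y = Obj \<alpha>" "\<mu> p1 z = Obj \<beta>"
    "\<mu> p0 w = Obj \<beta>" "before p1 w i" "before p1 y i" "before p1 z w" "\<alpha> \<noteq> \<beta>" "likes w x" "above w \<beta> x"
    by (rule wit[OF p1]) (rule that, assumption+)
  show ?thesis
  proof (cases "\<forall>p\<in>orders. \<mu> p i = Self i \<longrightarrow> \<mu> p w = Obj x")
    case True
    \<comment> \<open>\<open>w\<close> is fixed, but \<open>y\<close> and \<open>z\<close> may
      exchange roles between orders; hence the disjunction.\<close>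
    have "measure_pmf.prob rperm {p. \<mu> p i = Self i} \<le>
      measure_pmf.prob rperm {p. before p w i \<and> before p y i \<and> before p z i \<and> (before p y w \<or> before p z w)}"
    proof (rule rperm_mono, safe)
      fix p assume p: "p \<in> orders" "\<mu> p i = Self i"
      obtain w' y' z' \<beta>' where w': "distinct [i, w', y', z']" "\<mu> p w' = Obj x"
        "before p w' i" "before p y' i" "before p z' w'"
        by (rule wit[OF p]) (rule that, assumption+)
      have "w' = w" using True p w'(2) \<mu>_inj by blast
      moreover have "y = y' \<or> y = z'" "z = y' \<or> z = z'" "z' = y \<or> z' = z"
        using all[OF w(1), of z'] all[OF w'(1), of y] all[OF w'(1), of z] w(1) w'(1) \<open>w' = w\<close> by auto
      moreover have "before p z' i" using order_rules(3)[OF p(1)] w' by blast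
      ultimately show "before p w i" "before p y i" "before p z i"
        "\<not> before p z w \<Longrightarrow> before p y w"
        using w' by blast+
    qed
    also have "\<dots> = 1 / 6" by (rule prob_last_not_first[OF w(1)])
    finally show ?thesis .
  next
    case False
    then obtain p2 where p2: "p2 \<in> orders" "\<mu> p2 i = Self i" "\<mu> p2 w \<noteq> Obj x" by blast
    obtain w' y' z' \<beta>' where w': "distinct [i, w', y', z']" "\<mu> p2 w' = Obj x" "\<mu> p2 y' = Obj \<alpha>" "\<mu> p2 z' = Obj \<beta>'"
      "\<mu> p0 w' = Obj \<beta>'" "before p2 w' i" "before p2 y' i" "before p2 z' w'" "\<alpha> \<noteq> \<beta>'" "likes w' x" "above w' \<beta>' x"
      by (rule wit[OF p2(1,2)]) (rule that, assumption+)
    have neq: "w' \<noteq> w" using p2(3) w'(2) by auto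
    \<comment> \<open>Two agents who both receive \<open>x\<close> while \<open>i\<close> is unassigned: whenever one of them does,
      the other holds \<open>\<alpha>\<close>, since what the former would have had in \<open>p0\<close> is worse than \<open>x\<close> for the latter.\<close>
    have *: "\<mu> p v = Obj \<alpha>"
      if p: "p \<in> orders" "\<mu> p i = Self i" "\<mu> p u = Obj x"
        and q: "q \<in> orders" "\<mu> q i = Self i" "\<mu> q v = Obj x" and uv: "u \<noteq> v" for p q u v
    proof -
      obtain w y z \<beta> where w: "distinct [i, w, y, z]" "\<mu> p w = Obj x" "\<mu> p y = Obj \<alpha>" "\<mu> p z = Obj \<beta>"
        "\<mu> p0 w = Obj \<beta>" "before p z w"
        by (rule wit[OF p(1,2)]) (rule that, assumption+)
      have u: "w = u" using w p(3) \<mu>_inj by blast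
      obtain w' y' z' \<beta>' where w': "distinct [i, w', y', z']" "\<mu> q w' = Obj x" "\<mu> q y' = Obj \<alpha>"
        "\<mu> q z' = Obj \<beta>'" "\<mu> p0 w' = Obj \<beta>'" "likes w' x"
        by (rule wit[OF q(1,2)]) (rule that, assumption+)
      have v: "w' = v" using w' q(3) \<mu>_inj by blast
      have \<beta>: "\<beta> \<noteq> \<beta>'" "\<beta> \<noteq> \<alpha>" "\<beta> \<noteq> x"
        using w(1,5) w'(1,5) \<alpha> \<mu>_inj[of p0] u v uv p0(2) by force+
      have "v \<noteq> z"
      proof
        assume vz: "v = z"
        \<comment> \<open>Under \<open>q\<close> the four agents have \<open>Self i\<close>,
          \<open>x\<close>, \<alpha> and \<beta>', so \<beta> is unheld and \<open>v\<close>, who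
          holds \<open>x\<close>, cannot rank \<beta> higher.\<close>
        have "above v x \<beta>"
        proof (rule ccontr)
          assume "\<not> above v x \<beta>"
          then have "above v \<beta> x" using \<beta> prefers_total[of "Obj x" v "Obj \<beta>"] by auto
          then obtain t where t: "\<mu> q t = Obj \<beta>" using envy[OF q(1), of v \<beta>] q(3) by auto
          then have "t \<noteq> i" "t \<noteq> w'" "t \<noteq> y'" "t \<noteq> z'" using q w' \<beta> v by auto
          then show False using all[OF w'(1), of t] by auto
        qed
        \<comment> \<open>Holding \<beta> under \<open>p\<close>, \<open>v\<close> envies
          \<open>u\<close> for \<open>x\<close>, so \<open>u\<close> chooses before
          \<open>v\<close>; but the witness \<open>z\<close> chooses before
          \<open>u\<close>.\<close>
        then obtain t where "before p t v" "\<mu> p t = Obj x"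
          using envy[OF p(1), of v x] w(4) vz by auto
        then have "before p u v" using \<mu>_inj p(3) by blast
        then show False using w(6) u vz order_rules(2)[OF p(1)] by blast
      qed
      moreover have "v \<noteq> i" "v \<noteq> w" using w'(1) v u uv by auto
      ultimately show ?thesis using all[OF w(1), of v] w(3) by auto
    qed
    have w'y: "w' = y" using *[OF p1 w(2) p2(1,2) w'(2)] neq w(3) \<mu>_inj by blast
    \<comment> \<open>So only \<open>w\<close> and \<open>y\<close> ever receive \<open>x\<close>
      while \<open>i\<close> is unassigned; with the other one holding \<alpha>, the witness who
      precedes the recipient is always \<open>z\<close>.\<close>
    have zno: "\<mu> p z \<noteq> Obj x" if p: "p \<in> orders" "\<mu> p i = Self i" for p
    proof
      assume "\<mu> p z = Obj x"
      then have "\<mu> p1 z = Obj \<alpha>" using *[OF p1 w(2) p] w(1) by auto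
      then show False using w(1,3) \<mu>_inj[of p1 z \<alpha> y] by auto
    qed
    have "measure_pmf.prob rperm {p. \<mu> p i = Self i} \<le>
      measure_pmf.prob rperm {p. before p z i \<and> before p w i \<and> before p y i \<and> (before p z w \<or> before p z y)}"
    proof (rule rperm_mono, safe)
      fix p assume p: "p \<in> orders" "\<mu> p i = Self i"
      obtain w1 y1 z1 \<beta>1 where w1: "distinct [i, w1, y1, z1]" "\<mu> p w1 = Obj x" "\<mu> p y1 = Obj \<alpha>"
        "before p w1 i" "before p y1 i" "before p z1 w1"
        by (rule wit[OF p]) (rule that, assumption+)
      have "w1 \<noteq> z" using zno[OF p] w1(2) by auto
      then have c: "w1 = w \<or> w1 = y" using all[OF w(1), of w1] w1(1) by auto
      have yz1: "y1 = w \<and> w1 = y \<or> y1 = y \<and> w1 = w"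
        using c
      proof
        assume a: "w1 = w"
        then have "\<mu> p y = Obj \<alpha>" using *[OF p _ p2(1,2) w'(2), of w] w1(2) neq w'y by auto
        then show ?thesis using a w1(3) \<mu>_inj by blast
      next
        assume a: "w1 = y"
        then have "\<mu> p w = Obj \<alpha>" using *[OF p _ p1 w(2), of y] w1(2) neq w'y by auto
        then show ?thesis using a w1(3) \<mu>_inj by blast
      qed
      then have "z1 = z" using all[OF w(1), of z1] w1(1) by auto
      moreover have "before p z1 i" using order_rules(3)[OF p(1)] w1 by blast
      ultimately show "before p z i" "before p w i" "before p y i" "\<not> before p z y \<Longrightarrow> before p z w"
        using w1 yz1 by auto
    qed
    also have "\<dots> = 1 / 6" 
      by (rule prob_last_not_last_but_one) (use w(1) in auto)
    finally show ?thesis .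
  qed
qed


text \<open>More competitors of \<open>i\<close> and \<open>j\<close> for \<open>a\<close> and
  \<open>b\<close> make it easier to leave \<open>i\<close> unassigned but harder to keep
  \<open>x\<close> free. The cases therefore split on their number, and on whether \<open>i\<close>
  and \<open>j\<close> could also hold \<open>a\<close> and \<open>b\<close> the other way
  round.\<close>

lemma three_objects:
  assumes "CARD('o) = 3"
    and p0: "p0 \<in> orders" "\<forall>j. \<mu> p0 j \<noteq> Obj x" and i: "likes i x"
    and p1: "p1 \<in> orders" "\<mu> p1 i = Self i"
  shows "measure_pmf.prob rperm {p. \<mu> p i = Self i} \<le> 1 / 6 \<or>
         measure_pmf.prob rperm {p. \<forall>j. \<mu> p j \<noteq> Obj x} \<le> 1 / 6"
proof -
  obtain a where a: "\<mu> p0 i = Obj a" "above i a x" using free_above[OF p0 i] by blast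
  note wit = waste_witnesses[OF p0 i a(1)]
  obtain j y z b where w: "distinct [i, j, y, z]" "\<mu> p1 j = Obj x" "\<mu> p1 y = Obj a" "\<mu> p1 z = Obj b"
    "\<mu> p0 j = Obj b" "before p1 j i" "before p1 y i" "before p1 z j" "a \<noteq> b" "likes j x" "above j b x"
    by (rule wit[OF p1]) (rule that, assumption+)
  have abx: "a \<noteq> x" "b \<noteq> x" using p0(2) a(1) w(5) by metis+
  have "card {a, b, x} = CARD('o)" using assms(1) w(9) abx by simp
  then have "{a, b, x} = UNIV" by (intro card_subset_eq) auto
  then have objs: "c = a \<or> c = b \<or> c = x" for c by auto
  \<comment> \<open>Under \<open>p0\<close> everyone accepting \<open>x\<close> holds
    \<open>a\<close> or \<open>b\<close>, and these belong to \<open>i\<close> and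
    \<open>j\<close>.\<close>
  have acc: "k = i \<or> k = j" if k: "likes k x" for k
  proof -
    obtain c where "\<mu> p0 k = Obj c" using free_above[OF p0 k] by blast
    with objs[of c] p0(2) a(1) w(5) show ?thesis using \<mu>_inj by metis
  qed
  define K where "K c k \<longleftrightarrow> k \<noteq> i \<and> k \<noteq> j \<and> likes k c" for c k
  have yz: "K a y" "K b z" using w(1) \<mu>_likes[OF w(3)] \<mu>_likes[OF w(4)] by (auto simp: K_def)
  \<comment> \<open>The last conjunct: if \<open>j\<close> ranks \<open>a\<close> above
    \<open>x\<close> too, then his holding \<open>x\<close> shows that \<open>a\<close> was gone
    before his turn.\<close>
  have unassignedE: "\<exists>y' z'. K a y' \<and> K b z' \<and> y' \<noteq> z' \<and> before p y' i \<and> before p z' j \<and> before p j i \<and>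
      (above j a x \<longrightarrow> before p y' j)" if p: "p \<in> orders" "\<mu> p i = Self i" for p
  proof -
    obtain j' y' z' b' where w': "distinct [i, j', y', z']" "\<mu> p j' = Obj x" "\<mu> p y' = Obj a" "\<mu> p z' = Obj b'"
      "\<mu> p0 j' = Obj b'" "before p j' i" "before p y' i" "before p z' j'" "likes j' x"
      by (rule wit[OF p]) (rule that, assumption+)
    have j': "j' = j" using acc[OF w'(9)] w'(1) by auto
    have b': "b' = b" using w'(5) w(5) j' by simp
    have "K a y'" "K b z'" using w'(1) \<mu>_likes[OF w'(3)] \<mu>_likes[OF w'(4)] j' b' by (auto simp: K_def)
    moreover have "before p y' j" if ax: "above j a x"
    proof -
      obtain t where "before p t j" "\<mu> p t = Obj a" using envy[OF p(1), of j a] ax w'(2) j' by auto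
      then show ?thesis using \<mu>_inj w'(3) by blast
    qed
    ultimately show ?thesis using w' j' by auto
  qed
  \<comment> \<open>With \<open>x\<close> free, \<open>i\<close> and \<open>j\<close> hold
    \<open>a\<close> and \<open>b\<close>, all others are unassigned, and each competitor envies the
    holder of an object he accepts. \<open>s\<close> and \<open>t\<close> name \<open>i\<close> and
    \<open>j\<close> in either order.\<close>
  have freeE: "\<exists>c d. \<mu> p s = Obj c \<and> \<mu> p t = Obj d \<and> (c = a \<and> d = b \<or> c = b \<and> d = a) \<and>
      above s c x \<and> above t d x \<and> (\<forall>k. K c k \<longrightarrow> before p s k) \<and> (\<forall>k. K d k \<longrightarrow> before p t k)"
    if p: "p \<in> orders" "\<forall>j. \<mu> p j \<noteq> Obj x" and st: "s = i \<and> t = j \<or> s = j \<and> t = i" for p s t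
  proof -
    have l: "likes s x" "likes t x" "s \<noteq> t" using st i w(1,10) by auto
    obtain c where c: "\<mu> p s = Obj c" "above s c x" using free_above[OF p l(1)] by blast
    obtain d where d: "\<mu> p t = Obj d" "above t d x" using free_above[OF p l(2)] by blast
    have "c \<noteq> d" using \<mu>_inj[of p s c t] c(1) d(1) l(3) by blast
    moreover have "c \<noteq> x" "d \<noteq> x" using c d p(2) by metis+
    ultimately have cd: "c = a \<and> d = b \<or> c = b \<and> d = a" using objs[of c] objs[of d] by blast
    have k: "\<mu> p k = Self k" if "k \<noteq> i" "k \<noteq> j" for k
    proof (rule ccontr)
      assume "\<mu> p k \<noteq> Self k"
      then obtain e where e: "\<mu> p k = Obj e" using \<mu>_cases by blast
      then have "e = c \<or> e = d" using objs[of e] p(2) cd by blast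
      then have "k = s \<or> k = t" using \<mu>_inj e c(1) d(1) by blast
      then show False using that st by blast
    qed
    have "before p u k" if "K e k" "\<mu> p u = Obj e" for e k u
    proof -
      have "prefers R k (Obj e) (\<mu> p k)" using that(1) k[of k] by (simp add: K_def)
      then obtain t where "before p t k" "\<mu> p t = Obj e" using envy[OF p(1)] by blast
      then show ?thesis using \<mu>_inj that(2) by blast
    qed
    then show ?thesis using c d cd by blast
  qed
  show ?thesis
  proof (cases "\<forall>k. K a k \<or> K b k \<longrightarrow> k = y \<or> k = z")
    case True
    have "measure_pmf.prob rperm {p. \<mu> p i = Self i} \<le>
      measure_pmf.prob rperm {p. before p j i \<and> before p y i \<and> before p z i \<and> (before p y j \<or> before p z j)}"
    proof (rule rperm_mono, unfold mem_Collect_eq)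
      fix p assume p: "p \<in> orders" "\<mu> p i = Self i"
      obtain y' z' where y': "K a y'" "K b z'" "y' \<noteq> z'" "before p y' i" "before p z' j" "before p j i"
        using unassignedE[OF p] by blast
      have "before p z' i" using order_rules(3)[OF p(1)] y' by blast
      moreover have "y' = y \<and> z' = z \<or> y' = z \<and> z' = y" using True y'(1-3) by blast
      ultimately show "before p j i \<and> before p y i \<and> before p z i \<and> (before p y j \<or> before p z j)"
        using y' by blast
    qed
    also have "\<dots> = 1 / 6" by (rule prob_last_not_first[OF w(1)])
    finally show ?thesis by blast
  next
    case False
    then obtain u where u: "K a u \<or> K b u" "u \<noteq> y" "u \<noteq> z" by blast
    have uij: "u \<noteq> i" "u \<noteq> j" using u(1) by (auto simp: K_def)
    show ?thesis
    proof (cases "above i b x \<and> above j a x")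
      case False
      \<comment> \<open>Holding \<open>a\<close> and \<open>b\<close> the other way round would
        require both rankings excluded here, so \<open>i\<close> has \<open>a\<close> and
        \<open>j\<close> has \<open>b\<close>.\<close>
      have before_free: "\<forall>k. (K a k \<longrightarrow> before p i k) \<and> (K b k \<longrightarrow> before p j k)"
        if p: "p \<in> orders" "\<forall>j. \<mu> p j \<noteq> Obj x" for p
        using freeE[OF p, of i j] False by blast
      show ?thesis
      proof (cases "K a u")
        case True
        have "measure_pmf.prob rperm {p. \<forall>j. \<mu> p j \<noteq> Obj x} \<le>
          measure_pmf.prob rperm {p. before p i y \<and> before p i u \<and> before p j z}"
          by (rule rperm_mono, unfold mem_Collect_eq) (use before_free yz True in blast)
        also have "\<dots> = 1 / 6"
          by (rule prob_first_of_three_and_two) (use w(1) u uij in auto)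
        finally show ?thesis by blast
      next
        case False
        have "measure_pmf.prob rperm {p. \<forall>j. \<mu> p j \<noteq> Obj x} \<le>
          measure_pmf.prob rperm {p. before p j z \<and> before p j u \<and> before p i y}"
          by (rule rperm_mono, unfold mem_Collect_eq) (use before_free yz False u(1) in blast)
        also have "\<dots> = 1 / 6"
          by (rule prob_first_of_three_and_two) (use w(1) u uij in auto)
        finally show ?thesis by blast
      qed
    next
      case both: True
      show ?thesis
      proof (cases "\<forall>k. K a k \<or> K b k \<longrightarrow> k = y \<or> k = z \<or> k = u")
        case True
        \<comment> \<open>Now \<open>j\<close> gets \<open>x\<close> only after two of the three
          competitors have taken \<open>a\<close> and \<open>b\<close>.\<close>
        have "measure_pmf.prob rperm {p. \<mu> p i = Self i} \<le>
          measure_pmf.prob rperm {p. before p j i \<and> (before p y j \<and> before p z j \<or>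
            before p y j \<and> before p u j \<or> before p z j \<and> before p u j)}"
        proof (rule rperm_mono, unfold mem_Collect_eq)
          fix p assume p: "p \<in> orders" "\<mu> p i = Self i"
          obtain y' z' where y': "K a y'" "K b z'" "y' \<noteq> z'" "before p y' j" "before p z' j" "before p j i"
            using unassignedE[OF p] both by blast
          moreover have "y' = y \<or> y' = z \<or> y' = u" "z' = y \<or> z' = z \<or> z' = u" using True y'(1,2) by blast+
          ultimately show "before p j i \<and> (before p y j \<and> before p z j \<or>
            before p y j \<and> before p u j \<or> before p z j \<and> before p u j)" by auto
        qed
        also have "\<dots> = 3 / 20"
          by (rule prob_two_of_three_before) (use w(1) u uij in auto)
        finally show ?thesis by simp
      next
        case False
        then obtain v where v: "K a v \<or> K b v" "v \<noteq> y" "v \<noteq> z" "v \<noteq> u" by blast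
        have vij: "v \<noteq> i" "v \<noteq> j" using v(1) by (auto simp: K_def)
        have half: "measure_pmf.prob rperm {p. (\<forall>j. \<mu> p j \<noteq> Obj x) \<and> before p s t} \<le> 1 / 12"
          if st: "s = i \<and> t = j \<or> s = j \<and> t = i" for s t
        proof -
          \<comment> \<open>If \<open>s\<close> chooses before \<open>t\<close>, he gets his
            favourite \<open>f\<close> of the two objects and \<open>t\<close> gets
            \<open>g\<close>; \<open>r\<close> is a competitor for \<open>g\<close>.\<close>
          obtain f g where fg: "f = a \<and> g = b \<or> f = b \<and> g = a" "above s f g"
            using prefers_total[of "Obj a" s "Obj b"] w(9) by auto
          obtain r r' where r: "r = y \<and> r' = z \<or> r = z \<and> r' = y" "K g r"
            using fg(1) yz by blast
          have "measure_pmf.prob rperm {p. (\<forall>j. \<mu> p j \<noteq> Obj x) \<and> before p s t} \<le>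
            measure_pmf.prob rperm {p. before p s t \<and> before p s r \<and> before p s r' \<and> before p s u \<and>
              before p s v \<and> before p t r}"
          proof (rule rperm_mono, unfold mem_Collect_eq, elim conjE)
            fix p assume p: "p \<in> orders" "\<forall>j. \<mu> p j \<noteq> Obj x" and bst: "before p s t"
            obtain c d where c: "\<mu> p s = Obj c" "\<mu> p t = Obj d" "c = a \<and> d = b \<or> c = b \<and> d = a"
              "\<forall>k. K c k \<longrightarrow> before p s k" "\<forall>k. K d k \<longrightarrow> before p t k"
              using freeE[OF p st] by blast
            have "c = f"
            proof (rule ccontr)
              assume "c \<noteq> f"
              then have "c = g" "d = f" using c(3) fg(1) by blast+
              then obtain q where "before p q s" "\<mu> p q = Obj f"
                using envy[OF p(1), of s f] fg(2) c(1) by auto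
              then have "before p t s" using \<mu>_inj c(2) \<open>d = f\<close> by blast
              then show False using bst order_rules(2)[OF p(1)] by blast
            qed
            then have "d = g" using c(3) fg(1) by blast
            \<comment> \<open>Competitors for the object of \<open>t\<close> come after
              \<open>t\<close>, hence after \<open>s\<close>.\<close>
            have s: "before p s k" if "K a k \<or> K b k" for k
            proof -
              have "K c k \<or> K d k" using that c(3) by blast
              then show ?thesis using c(4,5) order_rules(3)[OF p(1) bst] by blast
            qed
            have "before p s y" "before p s z" "before p s u" "before p s v" using s yz u(1) v(1) by blast+
            moreover have "before p t r" using c(5) r(2) \<open>d = g\<close> by blast
            ultimately show "before p s t \<and> before p s r \<and> before p s r' \<and> before p s u \<and>
              before p s v \<and> before p t r" using r(1) bst by blast
          qed
          also have "\<dots> = 1 / 12"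
            by (rule prob_first_of_six) (use w(1) u v uij vij st r(1) in auto)
          finally show ?thesis .
        qed
        have "measure_pmf.prob rperm {p. \<forall>j. \<mu> p j \<noteq> Obj x} \<le> measure_pmf.prob rperm
          ({p. (\<forall>j. \<mu> p j \<noteq> Obj x) \<and> before p i j} \<union> {p. (\<forall>j. \<mu> p j \<noteq> Obj x) \<and> before p j i})"
          by (rule rperm_mono) (use order_rules(4)[of _ i j] w(1) in auto)
        also have "\<dots> \<le> measure_pmf.prob rperm {p. (\<forall>j. \<mu> p j \<noteq> Obj x) \<and> before p i j} +
          measure_pmf.prob rperm {p. (\<forall>j. \<mu> p j \<noteq> Obj x) \<and> before p j i}"
          by (rule measure_Un_le) auto
        also have "\<dots> \<le> 1 / 6" using half[of i j] half[of j i] by simp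
        finally show ?thesis by blast
      qed
    qed
  qed
qed

section \<open>Waste of 1/6 at a concrete profile\<close>

lemma wasteful_profile:
  assumes ijkl: "distinct [i, j, k, l]" and abx: "distinct [a, b, x]"
    and i: "above i a x" "likes i x" "\<And>c. likes i c \<Longrightarrow> c = a \<or> c = x"
    and j: "above j b x" "likes j x" "\<And>c. likes j c \<Longrightarrow> c = b \<or> c = x"
    and kl: "\<And>m. m = k \<or> m = l \<Longrightarrow> above m b a \<and> likes m a \<and> (\<forall>c. likes m c \<longrightarrow> c = a \<or> c = b)"
    and others: "\<And>m c. m \<notin> {i, j, k, l} \<Longrightarrow> \<not> likes m c"
  shows "wasteful (1 / 6) (RSD :: ('i, 'o) mechanism)"
proof -
  have "1 / 6 = measure_pmf.prob rperm {p. before p j i \<and> before p k i \<and> before p l i \<and>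
           (before p k j \<or> before p l j)}"
    by (rule prob_last_not_first[OF ijkl, symmetric])
  also have "\<dots> \<le> measure_pmf.prob rperm {p. \<mu> p i = Self i}"
  proof (rule rperm_mono, unfold mem_Collect_eq, elim conjE)
    fix p assume p: "p \<in> orders"
      and before: "before p j i" "before p k i" "before p l i" "before p k j \<or> before p l j"
    have noti: "\<not> before p i m" if "m = j \<or> m = k \<or> m = l" for m
      using before that order_rules(2)[OF p] by blast
    have "\<mu> p i \<noteq> Obj a"
    proof
      assume ia: "\<mu> p i = Obj a"
      \<comment> \<open>One of \<open>k\<close> and \<open>l\<close> misses \<open>b\<close>; if
        \<open>i\<close> had \<open>a\<close>, that agent would be unassigned and envy
        \<open>i\<close>, although he chooses before \<open>i\<close>.\<close>
      obtain m where m: "m = k \<or> m = l" "\<mu> p m \<noteq> Obj b"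
        using \<mu>_inj[of p k b l] ijkl by auto
      have "m \<noteq> i" using m(1) ijkl by auto
      then have "\<mu> p m \<noteq> Obj a" using \<mu>_inj[of p m a i] ia by blast
      then have "\<mu> p m = Self m" using m kl[OF m(1)] \<mu>_cases[of p m] \<mu>_likes[of p m] by metis
      then obtain t where "before p t m" "\<mu> p t = Obj a"
        using envy[OF p, of m a] kl[OF m(1)] by auto
      then have "before p i m" using \<mu>_inj ia by blast
      then show False using noti m(1) by blast
    qed
    moreover have "\<mu> p i \<noteq> Obj x"
    proof
      assume ix: "\<mu> p i = Obj x"
      have "\<mu> p j \<noteq> Obj x" using \<mu>_inj[of p j x i] ix ijkl by auto
      moreover have "\<mu> p j \<noteq> Self j"
      proof
        assume "\<mu> p j = Self j"
        then obtain t where "before p t j" "\<mu> p t = Obj x" using envy[OF p, of j x] j(2) by auto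
        then show False using \<mu>_inj ix noti by blast
      qed
      ultimately have jb: "\<mu> p j = Obj b" using \<mu>_cases[of p j] \<mu>_likes[of p j] j(3) by metis
      \<comment> \<open>This agent chooses before \<open>j\<close> and ranks \<open>b\<close> first,
        so \<open>j\<close> cannot hold \<open>b\<close>.\<close>
      obtain m where m: "m = k \<or> m = l" "before p m j" using before(4) by blast
      then have "m \<noteq> j" using ijkl by auto
      then have "\<mu> p m \<noteq> Obj b" using \<mu>_inj[of p m b j] jb by blast
      then have "\<mu> p m = Self m \<or> \<mu> p m = Obj a"
        using kl[OF m(1)] \<mu>_cases[of p m] \<mu>_likes[of p m] by metis
      then have "prefers R m (Obj b) (\<mu> p m)"
        using kl[OF m(1)] prefers_trans[of m "Obj b" "Obj a" "Self m"] by auto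
      then obtain t where "before p t m" "\<mu> p t = Obj b" using envy[OF p] by blast
      then have "before p j m" using \<mu>_inj jb by blast
      then show False using m(2) order_rules(2)[OF p] by blast
    qed
    ultimately show "\<mu> p i = Self i" using \<mu>_cases[of p i] \<mu>_likes[of p i] i(3) by metis
  qed
  finally have un: "1 / 6 \<le> assign_prob RSD R i (Self i)" by (simp add: assign_prob_RSD)
  have "1 / 6 = measure_pmf.prob rperm {p. before p i k \<and> before p i l \<and> before p j k \<and> before p j l}"
    by (rule prob_two_first[OF ijkl, symmetric])
  also have "\<dots> \<le> measure_pmf.prob rperm {p. \<forall>j. \<mu> p j \<noteq> Obj x}"
  proof (rule rperm_mono, unfold mem_Collect_eq, elim conjE, intro allI notI)
    fix p m assume p: "p \<in> orders" and m: "\<mu> p m = Obj x"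
      and before: "before p i k" "before p i l" "before p j k" "before p j l"
    note lm = \<mu>_likes[OF m]
    have "m \<noteq> k" "m \<noteq> l" using lm kl[of m] abx by auto
    then have "m = i \<or> m = j" using lm others[of m x] by auto
    then obtain c where c: "m = i \<and> c = a \<or> m = j \<and> c = b" "above m c x"
      using i(1) j(1) by blast
    \<comment> \<open>The favourite \<open>c\<close> of \<open>m\<close> was taken earlier by some
      \<open>t\<close>; apart from \<open>m\<close>, only \<open>k\<close> and \<open>l\<close>
      accept \<open>c\<close>, and they choose after \<open>m\<close>.\<close>
    then obtain t where t: "before p t m" "\<mu> p t = Obj c" using envy[OF p, of m c] m by auto
    have nt: "t \<noteq> k" "t \<noteq> l" using t(1) c(1) before order_rules(2)[OF p] by blast+
    have lt: "likes t c" using \<mu>_likes[OF t(2)] .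
    have "t = i \<or> t = j" using others[of t c] lt nt by auto
    moreover have "t \<noteq> m" using t(1) order_rules(1)[OF p] by blast
    ultimately show False using c(1) lt i(3) j(3) abx by auto
  qed
  finally have "1 / 6 \<le> free_prob RSD R x" by (simp add: free_prob_RSD[OF R])
  with un show ?thesis unfolding wasteful_def using R i(2) by auto
qed

end

subsection \<open>Attaining the bound\<close>

lemma linear_order_on_inj:
  fixes h :: "'a \<Rightarrow> nat"
  assumes "inj_on h B"
  shows "linear_order_on B {(u, v). u \<in> B \<and> v \<in> B \<and> h u \<le> h v}"
  using assms
  by (auto simp: order_on_defs refl_on_def trans_def antisym_def total_on_def inj_on_def)

text \<open>Counterpart of \<open>prefers\<close> for a single relation, available before a profile
  has been assembled.\<close>

definition strictly :: "'a rel \<Rightarrow> 'a \<Rightarrow> 'a \<Rightarrow> bool" where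
  "strictly r a b \<longleftrightarrow> (a, b) \<in> r \<and> (b, a) \<notin> r"

lemma preference_two_objects:
  fixes c d :: "'o::finite" and i :: 'i
  assumes "c \<noteq> d"
  shows "\<exists>r. linear_order_on (outcomes i) r \<and> strictly r (Obj c) (Obj d) \<and> strictly r (Obj d) (Self i) \<and>
           (\<forall>e. strictly r (Obj e) (Self i) \<longrightarrow> e = c \<or> e = d)"
proof -
  have "finite (outcomes i :: ('i, 'o) outcome set)" by (simp add: outcomes_def)
  from finite_imp_inj_to_nat_seg[OF this]
  obtain g :: "('i, 'o) outcome \<Rightarrow> nat" where g: "inj_on g (outcomes i)" by blast
  \<comment> \<open>Ranks, smaller being better. The shift by 3 keeps \<open>h\<close> injective and
    puts all other objects below the outside option.\<close>
  define h where "h u = (if u = Obj c then 0 else if u = Obj d then 1 else if u = Self i then 2 else g u + 3)" for u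
  let ?r = "{(u, v). u \<in> outcomes i \<and> v \<in> outcomes i \<and> h u \<le> h v}"
  have "inj_on h (outcomes i)" using g by (auto simp: inj_on_def h_def)
  from linear_order_on_inj[OF this] show ?thesis
    using assms by (intro exI[of _ ?r]) (auto simp: strictly_def h_def outcomes_def)
qed

lemma preference_no_object:
  fixes i :: 'i
  shows "\<exists>r. linear_order_on (outcomes i) r \<and> (\<forall>e :: 'o::finite. \<not> strictly r (Obj e) (Self i))"
proof -
  have "finite (outcomes i :: ('i, 'o) outcome set)" by (simp add: outcomes_def)
  from finite_imp_inj_to_nat_seg[OF this]
  obtain g :: "('i, 'o) outcome \<Rightarrow> nat" where g: "inj_on g (outcomes i)" by blast
  define h where "h u = (if u = Self i then 0 else g u + 1)" for u
  let ?r = "{(u, v). u \<in> outcomes i \<and> v \<in> outcomes i \<and> h u \<le> h v}"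
  have "inj_on h (outcomes i)" using g by (auto simp: inj_on_def h_def)
  from linear_order_on_inj[OF this] show ?thesis
    by (intro exI[of _ ?r]) (auto simp: strictly_def h_def outcomes_def)
qed

lemma RSD_wasteful:
  assumes "CARD('i::finite) \<ge> 4" "CARD('o::finite) \<ge> 3"
  shows "wasteful (1 / 6) (RSD :: ('i, 'o) mechanism)"
proof -
  obtain I :: "'i set" where "card I = 4" using obtain_subset_with_card_n[OF assms(1)] by blast
  then obtain i j k l where "I = {i, j, k, l}" and ijkl: "distinct [i, j, k, l]"
    by (auto simp: eval_nat_numeral card_Suc_eq)
  obtain O' :: "'o set" where "card O' = 3" using obtain_subset_with_card_n[OF assms(2)] by blast
  then obtain a b x where "O' = {a, b, x}" and abx: "distinct [a, b, x]"
    by (auto simp: eval_nat_numeral card_Suc_eq)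
  \<comment> \<open>Each agent's two acceptable objects, better one first; \<open>None\<close> for
    the further agents, who accept nothing.\<close>
  define P where "P m = (if m = i then Some (a, x) else if m = j then Some (b, x)
    else if m = k \<or> m = l then Some (b, a) else None)" for m
  define ok where "ok m r \<longleftrightarrow> linear_order_on (outcomes m) r \<and>
      (case P m of None \<Rightarrow> \<forall>e. \<not> strictly r (Obj e) (Self m)
       | Some (c, d) \<Rightarrow> strictly r (Obj c) (Obj d) \<and> strictly r (Obj d) (Self m) \<and>
           (\<forall>e. strictly r (Obj e) (Self m) \<longrightarrow> e = c \<or> e = d))"
    for m and r :: "('i, 'o) outcome rel"
  have "\<exists>r. ok m r" for m
  proof (cases "P m")
    case None
    then show ?thesis using preference_no_object[of m] by (simp add: ok_def)
  next
    case (Some q)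
    moreover have "fst q \<noteq> snd q" using Some abx by (auto simp: P_def split: if_splits)
    ultimately show ?thesis using preference_two_objects[of "fst q" "snd q" m]
      by (simp add: ok_def split_beta)
  qed
  then obtain R where ok: "\<And>m. ok m (R m)" by metis
  then interpret serial R by unfold_locales (simp add: profiles_def ok_def)
  have s: "strictly (R m) u v = prefers R m u v" for m u v by (simp add: strictly_def prefers_def)
  have Some: "above m c d \<and> likes m d \<and> (\<forall>e. likes m e \<longrightarrow> e = c \<or> e = d)" if "P m = Some (c, d)" for m c d
    using ok[of m] that by (simp add: ok_def s)
  have None: "\<not> likes m e" if "P m = None" for m e
    using ok[of m] that by (simp add: ok_def s)
  have P: "P i = Some (a, x)" "P j = Some (b, x)" "\<And>m. m = k \<or> m = l \<Longrightarrow> P m = Some (b, a)"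
    "\<And>m. m \<notin> {i, j, k, l} \<Longrightarrow> P m = None"
    using ijkl by (auto simp: P_def)
  show ?thesis
  proof (rule wasteful_profile[OF ijkl abx])
    show "above i a x" "likes i x" "\<And>c. likes i c \<Longrightarrow> c = a \<or> c = x"
      using Some[OF P(1)] by blast+
    show "above j b x" "likes j x" "\<And>c. likes j c \<Longrightarrow> c = b \<or> c = x"
      using Some[OF P(2)] by blast+
    show "above m b a \<and> likes m a \<and> (\<forall>c. likes m c \<longrightarrow> c = a \<or> c = b)" if "m = k \<or> m = l" for m
      using Some[OF P(3)[OF that]] by blast
    show "\<not> likes m c" if "m \<notin> {i, j, k, l}" for m c
      using None[OF P(4)[OF that]] .
  qed
qed

theorem lemma1:
  shows "(CARD('i::finite) \<ge> 4 \<and> CARD('o::finite) = 3 \<longrightarrow>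
            at_most_wasteful (1/6) (RSD :: ('i, 'o) mechanism)) \<and>
         (CARD('i) = 4 \<and> CARD('o) \<ge> 3 \<longrightarrow>
            at_most_wasteful (1/6) (RSD :: ('i, 'o) mechanism))"
proof -
  have upper: "\<not> wasteful q (RSD :: ('i, 'o) mechanism)"
    if q: "q > 1 / 6" and card: "CARD('o) = 3 \<or> CARD('i) = 4" for q
  proof
    assume "wasteful q (RSD :: ('i, 'o) mechanism)"
    then obtain R :: "('i, 'o) profile" and x i where R: "R \<in> profiles"
      and l: "prefers R i (Obj x) (Self i)"
      and min: "q \<le> assign_prob RSD R i (Self i)" "q \<le> free_prob RSD R x"
      unfolding wasteful_def by auto
    interpret serial R by unfold_locales (rule R)
    note prob = min[unfolded assign_prob_RSD free_prob_RSD[OF R]]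
    \<comment> \<open>As \<open>q\<close> is positive, both events occur, which yields the orders
      \<open>p0\<close> and \<open>p1\<close> that the upper bounds start from.\<close>
    have pos: "0 < measure_pmf.prob rperm {p. \<mu> p i = Self i}"
      "0 < measure_pmf.prob rperm {p. \<forall>j. \<mu> p j \<noteq> Obj x}"
      using prob q by linarith+
    obtain p1 where p1: "p1 \<in> orders" "\<mu> p1 i = Self i"
      by (rule rperm_pos[OF pos(1)])
    obtain p0 where p0: "p0 \<in> orders" "\<forall>j. \<mu> p0 j \<noteq> Obj x"
      by (rule rperm_pos[OF pos(2)])
    from card show False
    proof
      assume "CARD('o) = 3"
      from three_objects[OF this p0 l p1] show False using prob q by linarith
    next
      assume "CARD('i) = 4"
      from four_agents[OF this p0 l] show False using prob q by linarith
    qed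
  qed
  then show ?thesis
    using RSD_wasteful[where 'i = 'i and 'o = 'o] by (auto simp: at_most_wasteful_def)
qed

end
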